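(* Let $\mu,\nu\in\mathcal M$ with $\mu(\mathbb R)=\nu(\mathbb R)$ and $\min\{p_{\mu,\nu},c_{\mu,\nu}\}>0$. Then the optimal map $T^*$ for $(\mu,\nu)$ is such that $x\mapsto D(x):=T^*(x)-x$ is non-increasing, and $$D>0\ \text{ on }(-\infty,x^-),\qquad D=0\ \text{ on }[x^-,x^+],\qquad D<0\ \text{ on }(x^+,\infty).$$
   Context: $\mathcal M$ is the set of Borel measures $\eta$ on $\mathbb R$ with $\eta(\mathbb R)<\infty$ and $\int|x|\,\eta(dx)<\infty$. For $\eta\in\mathcal M$: $P_\eta(k)=\int(k-x)^+\eta(dx)$, $C_\eta(k)=\int(x-k)^+\eta(dx)$. $\eta\le_c\chi$ means $\int f\,d\eta\le\int f\,d\chi$ for all convex $f:\mathbb R\to\mathbb R$. For $\eta,\chi\in\mathcal M$ of equal mass, $\Pi(\eta,\chi)$ is the set of measures on $\mathbb R^2$ with marginals $\eta,\chi$; $\pi(dx,dy)=\pi_x(dy)\eta(dx)$ denotes disintegration. For convex $h:\mathbb R\to[0,\infty)$ with $h(0)=0$, $$V_h(\eta,\chi)=\inf_{\pi\in\Pi(\eta,\chi)}\int h\Big(x-\int y\,\pi_x(dy)\Big)\eta(dx),\qquad \bar V_h(\eta,\chi)=\inf_{\pi\in\Pi(\eta,\chi)}\int h(x-y)\,\pi(dx,dy).$$ A map $S:\mathbb R\to\mathbb R$ is admissible (w.r.t. $(\mu,\nu)$) if it is non-decreasing, $1$-Lipschitz, and the push-forward $S(\mu)$ satisfies $S(\mu)\le_c\nu$.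 It is known from previous work that there exists an admissible ($\mu$-a.s. unique) map $T^*$, called the optimal map, such that $V_h(\mu,\nu)=\bar V_h(\mu,T^*(\mu))$ for all convex $h:\mathbb R\to[0,\infty)$ with $h(0)=0$. It is uniquely identified by either of the following conditions: (1) $S(\mu)\le_c T^*(\mu)\le_c\nu$ for all admissible $S$; (2) $T^*$ is the unique admissible map which has slope $1$ on each interval $(T^* )^{-1}(I)$, where $I$ is any connected component of the open set $\{k:P_{T^*(\mu)}(k)<P_\nu(k)\}$. $p_{\mu,\nu}=\sup_k\{P_\mu(k)-P_\nu(k)\}$, $c_{\mu,\nu}=\sup_k\{C_\mu(k)-C_\nu(k)\}$. If both are $>0$, then $$x^-=\inf\{k:P_\nu(k)+p_{\mu,\nu}=P_\mu(k)\},\qquad x^+=\sup\{k:P_\nu(k)+p_{\mu,\nu}=P_\mu(k)\},$$ which are real numbers with $x^-\le x^+$.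
   Formalization: As T* is only μ-a.s. unique, D = 0 on [x^-,x^+] can fail off the support of μ. Every optimal T* with slope 1 as in (2) is shown to have D non-increasing, both strict signs everywhere, and D = 0 μ-a.e. on [x^-,x^+]; some μ-a.s. equal optimal version has D = 0 at every point there. *)

theory Defs
  imports "HOL-Probability.Probability"
begin

definition meas_class :: "real measure set" where
  "meas_class = {\<eta>. sets \<eta> = sets borel \<and> finite_measure \<eta> \<and> integrable \<eta> (\<lambda>x. x)}"

definition put_fun :: "real measure \<Rightarrow> real \<Rightarrow> real" where
  "put_fun \<eta> k = (\<integral>x. max (k - x) 0 \<partial>\<eta>)"

definition call_fun :: "real measure \<Rightarrow> real \<Rightarrow> real" where
  "call_fun \<eta> k = (\<integral>x. max (x - k) 0 \<partial>\<eta>)"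

text \<open>
  For measures with finite first moment, a convex \<open>f\<close> has an affine minorant, so its integral
  exists in \<open>(-\<infinity>, \<infinity>]\<close> and is finite iff \<open>f\<close> is integrable. Only functions \<open>f\<close> with finite
  integral against \<open>\<theta>\<close> give a nontrivial inequality, and for these the integral
  against \<open>\<eta>\<close> has to be finite as well.
\<close>
definition convex_le :: "real measure \<Rightarrow> real measure \<Rightarrow> bool" where
  "convex_le \<eta> \<theta> \<longleftrightarrow>
     (\<forall>f :: real \<Rightarrow> real. convex_on UNIV f \<longrightarrow> integrable \<theta> f \<longrightarrow>
        integrable \<eta> f \<and> (\<integral>x. f x \<partial>\<eta>) \<le> (\<integral>x. f x \<partial>\<theta>))"

definition couplings :: "real measure \<Rightarrow> real measure \<Rightarrow> (real \<times> real) measure set" where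
  "couplings \<eta> \<theta> = {\<pi>. sets \<pi> = sets borel \<and> distr \<pi> borel fst = \<eta> \<and> distr \<pi> borel snd = \<theta>}"

text \<open>\<open>\<pi>(dx,dy) = \<kappa>\<^sub>x(dy) \<eta>(dx)\<close> for a probability kernel \<open>\<kappa>\<close>.\<close>
definition disintegrates ::
    "(real \<times> real) measure \<Rightarrow> real measure \<Rightarrow> (real \<Rightarrow> real measure) \<Rightarrow> bool" where
  "disintegrates \<pi> \<eta> \<kappa> \<longleftrightarrow>
     \<kappa> \<in> borel \<rightarrow>\<^sub>M prob_algebra borel \<and>
     (\<forall>A \<in> sets (borel :: (real \<times> real) measure).
        emeasure \<pi> A = (\<integral>\<^sup>+x. emeasure (\<kappa> x) {y. (x, y) \<in> A} \<partial>\<eta>))"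

text \<open>
  The disintegration of \<open>\<pi>\<close> exists and is \<open>\<eta>\<close>-a.e. unique, so the infimum over pairs of a
  coupling and a disintegration of it is the infimum over couplings.
\<close>
definition weak_cost :: "(real \<Rightarrow> real) \<Rightarrow> real measure \<Rightarrow> real measure \<Rightarrow> ennreal" where
  "weak_cost h \<eta> \<theta> =
     (INF (\<pi>, \<kappa>) \<in> {(\<pi>, \<kappa>). \<pi> \<in> couplings \<eta> \<theta> \<and> disintegrates \<pi> \<eta> \<kappa>}.
        \<integral>\<^sup>+x. ennreal (h (x - (\<integral>y. y \<partial>(\<kappa> x)))) \<partial>\<eta>)"

definition transport_cost :: "(real \<Rightarrow> real) \<Rightarrow> real measure \<Rightarrow> real measure \<Rightarrow> ennreal" where
  "transport_cost h \<eta> \<theta> =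
     (INF \<pi> \<in> couplings \<eta> \<theta>. \<integral>\<^sup>+(x, y). ennreal (h (x - y)) \<partial>\<pi>)"

definition admissible :: "real measure \<Rightarrow> real measure \<Rightarrow> (real \<Rightarrow> real) \<Rightarrow> bool" where
  "admissible \<mu> \<nu> S \<longleftrightarrow>
     mono S \<and> 1-lipschitz_on UNIV S \<and> convex_le (distr \<mu> borel S) \<nu>"

text \<open>An admissible \<open>T\<close> is monotone and continuous, so each \<open>T -` I\<close> below is an interval.\<close>
definition slope_one_off_contact :: "real measure \<Rightarrow> real measure \<Rightarrow> (real \<Rightarrow> real) \<Rightarrow> bool" where
  "slope_one_off_contact \<mu> \<nu> T \<longleftrightarrow>
     (\<forall>I \<in> components {k. put_fun (distr \<mu> borel T) k < put_fun \<nu> k}.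
        \<forall>x \<in> T -` I. \<forall>y \<in> T -` I. T y - T x = y - x)"

text \<open>
  The cost identity depends on \<open>T\<close> only through its push-forward and hence fixes \<open>T\<close> only up to
  \<open>\<mu>\<close>-null sets. The slope condition, which is known to characterise the same map, is a
  condition on \<open>T\<close> as a function. It is required in addition because the strict inequalities for
  \<open>T x - x\<close> may fail, off the support of \<open>\<mu>\<close>, for a version of the map that violates it.
\<close>
definition optimal_map :: "real measure \<Rightarrow> real measure \<Rightarrow> (real \<Rightarrow> real) \<Rightarrow> bool" where
  "optimal_map \<mu> \<nu> T \<longleftrightarrow>
     admissible \<mu> \<nu> T \<and>
     (\<forall>h. convex_on UNIV h \<longrightarrow> (\<forall>x. 0 \<le> h x) \<longrightarrow> h 0 = 0 \<longrightarrow>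
        weak_cost h \<mu> \<nu> = transport_cost h \<mu> (distr \<mu> borel T)) \<and>
     slope_one_off_contact \<mu> \<nu> T"

definition put_gap :: "real measure \<Rightarrow> real measure \<Rightarrow> real" where
  "put_gap \<mu> \<nu> = (SUP k. put_fun \<mu> k - put_fun \<nu> k)"

definition call_gap :: "real measure \<Rightarrow> real measure \<Rightarrow> real" where
  "call_gap \<mu> \<nu> = (SUP k. call_fun \<mu> k - call_fun \<nu> k)"

definition x_minus :: "real measure \<Rightarrow> real measure \<Rightarrow> real" where
  "x_minus \<mu> \<nu> = Inf {k. put_fun \<nu> k + put_gap \<mu> \<nu> = put_fun \<mu> k}"

definition x_plus :: "real measure \<Rightarrow> real measure \<Rightarrow> real" where
  "x_plus \<mu> \<nu> = Sup {k. put_fun \<nu> k + put_gap \<mu> \<nu> = put_fun \<mu> k}"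

end

theory Submission
  imports Defs
begin

text \<open>
  Write \<open>\<eta> = T(\<mu>)\<close>. Since \<open>\<eta>\<close> is below \<open>\<nu>\<close> in convex order, and since
  \<open>(k - x)\<^sup>+ - (k - T x)\<^sup>+ \<le> (T x - x)\<^sup>+\<close> pointwise,
  \<open>P\<^sub>\<mu>(k) - P\<^sub>\<nu>(k) \<le> P\<^sub>\<mu>(k) - P\<^sub>\<eta>(k) \<le> \<integral>(T x - x)\<^sup>+ \<mu>(dx)\<close>
  for every \<open>k\<close>. Both inequalities can be equalities. The first one is an equality
  iff \<open>k\<close> is a point of contact of \<open>P\<^sub>\<eta>\<close> and \<open>P\<^sub>\<nu>\<close>; the second one is an equality iff \<open>T\<close>
  moves \<open>\<mu>\<close>-almost every point towards \<open>k\<close> without crossing \<open>k\<close>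
  (\<open>AE_moves_towards_maximizer\<close>). A monotone \<open>T\<close> with non-increasing displacement does the latter
  for each fixed point \<open>k\<close> of \<open>T\<close>.

  The displacement is non-increasing because \<open>T\<close> is 1-Lipschitz. Positivity of the two gaps
  forces it to take both signs, so the fixed points of \<open>T\<close> form a compact interval \<open>[a, b]\<close>,
  with points moved to the right before \<open>a\<close> and to the left after \<open>b\<close>. Off the contact set \<open>T\<close>
  has slope one, so a fixed point which is not a contact point is surrounded by fixed points;
  hence the end points \<open>a\<close> and \<open>b\<close> are contact points. They are therefore maximizers
  of \<open>P\<^sub>\<mu> - P\<^sub>\<nu>\<close>, and \<open>x\<^sup>- \<le> a \<le> b \<le> x\<^sup>+\<close>, which gives the two strict inequalities.

  The points \<open>x\<^sup>-\<close> and \<open>x\<^sup>+\<close> are maximizers too, because the set of maximizers is compact. Almost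
  every point between them is moved towards both of them, that is, not at all. Where \<open>T\<close> differs from
  the identity on this interval it can be corrected: clamping \<open>T\<close>
  (\<open>clamped_map\<close>) changes it only on a null set, keeps it non-decreasing and 1-Lipschitz, and keeps
  the slope condition because \<open>x\<^sup>-\<close> and \<open>x\<^sup>+\<close> are contact points. The cost identity is
  inherited since it depends on \<open>T\<close> only through \<open>T(\<mu>)\<close>.
\<close>

section \<open>Put and call functions\<close>

lemma meas_classD:
  assumes "\<eta> \<in> meas_class"
  shows "sets \<eta> = sets borel" "space \<eta> = UNIV" "finite_measure \<eta>" "integrable \<eta> (\<lambda>x. x)"
  using assms sets_eq_imp_space_eq[of \<eta> borel] by (auto simp: meas_class_def)

lemma meas_class_integrable_linear_growth:
  fixes f :: "real \<Rightarrow> real"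
  assumes "\<eta> \<in> meas_class" and "f \<in> borel_measurable borel" and "\<And>x. \<bar>f x\<bar> \<le> c + \<bar>x\<bar>"
  shows "integrable \<eta> f"
proof (rule Bochner_Integration.integrable_bound)
  note \<eta> = meas_classD[OF assms(1)]
  interpret finite_measure \<eta> by (rule \<eta>)
  show "integrable \<eta> (\<lambda>x. c + \<bar>x\<bar>)"
    using \<eta>(4) by auto
  show "f \<in> borel_measurable \<eta>"
    using assms(2) \<eta>(1) by (simp cong: measurable_cong_sets)
  show "AE x in \<eta>. norm (f x) \<le> norm (c + \<bar>x\<bar>)"
    using assms(3) by (auto intro!: AE_I2 order_trans[OF _ abs_ge_self])
qed

lemma integrable_put [intro]:
  assumes "\<eta> \<in> meas_class"
  shows "integrable \<eta> (\<lambda>x. max (k - x) 0)"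
  by (rule meas_class_integrable_linear_growth[OF assms, where c = "\<bar>k\<bar>"]) auto

lemma integrable_call [intro]:
  assumes "\<eta> \<in> meas_class"
  shows "integrable \<eta> (\<lambda>x. max (x - k) 0)"
  by (rule meas_class_integrable_linear_growth[OF assms, where c = "\<bar>k\<bar>"]) auto

lemma put_fun_nonneg: "0 \<le> put_fun \<eta> k"
  unfolding put_fun_def by (rule Bochner_Integration.integral_nonneg) auto

lemma call_fun_nonneg: "0 \<le> call_fun \<eta> k"
  unfolding call_fun_def by (rule Bochner_Integration.integral_nonneg) auto

lemma put_call_parity:
  assumes "\<eta> \<in> meas_class"
  shows "put_fun \<eta> k - call_fun \<eta> k = k * measure \<eta> UNIV - (\<integral>x. x \<partial>\<eta>)"
proof -
  note \<eta> = meas_classD[OF assms]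
  interpret finite_measure \<eta> by (rule \<eta>)
  have "put_fun \<eta> k - call_fun \<eta> k = (\<integral>x. max (k - x) 0 - max (x - k) 0 \<partial>\<eta>)"
    unfolding put_fun_def call_fun_def
    by (rule Bochner_Integration.integral_diff[symmetric]) (use assms in auto)
  also have "\<dots> = (\<integral>x. k - x \<partial>\<eta>)"
    by (intro Bochner_Integration.integral_cong) auto
  also have "\<dots> = k * measure \<eta> UNIV - (\<integral>x. x \<partial>\<eta>)"
    using \<eta> by (subst Bochner_Integration.integral_diff) auto
  finally show ?thesis .
qed

lemma continuous_on_put_fun:
  assumes "\<eta> \<in> meas_class"
  shows "continuous_on UNIV (put_fun \<eta>)"
proof -
  note \<eta> = meas_classD[OF assms]
  interpret finite_measure \<eta> by (rule \<eta>)
  have upper: "put_fun \<eta> k \<le> put_fun \<eta> l + measure \<eta> UNIV * \<bar>k - l\<bar>" for k l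
  proof -
    have "put_fun \<eta> k \<le> (\<integral>x. max (l - x) 0 + \<bar>k - l\<bar> \<partial>\<eta>)"
      unfolding put_fun_def using assms by (intro integral_mono) auto
    also have "\<dots> = put_fun \<eta> l + measure \<eta> UNIV * \<bar>k - l\<bar>"
      unfolding put_fun_def
      by (subst Bochner_Integration.integral_add) (use assms \<eta> in auto)
    finally show ?thesis .
  qed
  have "(measure \<eta> UNIV)-lipschitz_on UNIV (put_fun \<eta>)"
  proof (rule lipschitz_onI)
    fix k l
    show "dist (put_fun \<eta> k) (put_fun \<eta> l) \<le> measure \<eta> UNIV * dist k l"
      using upper[of k l] upper[of l k] by (simp add: dist_real_def abs_minus_commute)
  qed simp
  then show ?thesis
    by (rule lipschitz_on_continuous_on)
qed

lemma put_fun_eventually_less: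
  assumes "\<eta> \<in> meas_class" and "0 < e"
  obtains l where "\<And>k. k \<le> l \<Longrightarrow> put_fun \<eta> k < e"
proof -
  note \<eta> = meas_classD[OF assms(1)]
  have "((\<lambda>t. \<integral>x. max (- t - x) 0 \<partial>\<eta>) \<longlongrightarrow> (\<integral>x. 0 \<partial>\<eta>)) at_top"
  proof (rule integral_dominated_convergence_at_top[where w = "\<lambda>x. \<bar>x\<bar>"])
    show "\<forall>\<^sub>F t in at_top. AE x in \<eta>. norm (max (- t - x) 0) \<le> \<bar>x\<bar>"
      using eventually_ge_at_top[of 0] by eventually_elim auto
    have "\<forall>\<^sub>F t in at_top. max (- t - x) 0 = 0" for x :: real
      using eventually_ge_at_top[of "- x"] by eventually_elim auto
    then show "AE x in \<eta>. ((\<lambda>t. max (- t - x) 0) \<longlongrightarrow> 0) at_top"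
      by (auto intro!: tendsto_eventually)
    show "integrable \<eta> (\<lambda>x. \<bar>x\<bar>)"
      by (rule integrable_abs[OF \<eta>(4)])
  qed (rule borel_measurable_integrable[OF integrable_put[OF assms(1)]] borel_measurable_const)+
  then have "\<forall>\<^sub>F t in at_top. put_fun \<eta> (- t) < e"
    using assms(2) by (auto simp: put_fun_def dest: order_tendstoD(2))
  then obtain t where t: "\<And>s. s \<ge> t \<Longrightarrow> put_fun \<eta> (- s) < e"
    by (auto simp: eventually_at_top_linorder)
  show thesis
  proof
    show "put_fun \<eta> k < e" if "k \<le> - t" for k
      using t[of "- k"] that by simp
  qed
qed

lemma call_fun_eventually_less:
  assumes "\<eta> \<in> meas_class" and "0 < e"
  obtains u where "\<And>k. u \<le> k \<Longrightarrow> call_fun \<eta> k < e"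
proof -
  note \<eta> = meas_classD[OF assms(1)]
  have "((\<lambda>k. \<integral>x. max (x - k) 0 \<partial>\<eta>) \<longlongrightarrow> (\<integral>x. 0 \<partial>\<eta>)) at_top"
  proof (rule integral_dominated_convergence_at_top[where w = "\<lambda>x. \<bar>x\<bar>"])
    show "\<forall>\<^sub>F k in at_top. AE x in \<eta>. norm (max (x - k) 0) \<le> \<bar>x\<bar>"
      using eventually_ge_at_top[of 0] by eventually_elim auto
    have "\<forall>\<^sub>F k in at_top. max (x - k) 0 = 0" for x :: real
      using eventually_ge_at_top[of x] by eventually_elim auto
    then show "AE x in \<eta>. ((\<lambda>k. max (x - k) 0) \<longlongrightarrow> 0) at_top"
      by (auto intro!: tendsto_eventually)
    show "integrable \<eta> (\<lambda>x. \<bar>x\<bar>)"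
      by (rule integrable_abs[OF \<eta>(4)])
  qed (rule borel_measurable_integrable[OF integrable_call[OF assms(1)]] borel_measurable_const)+
  then have "\<forall>\<^sub>F k in at_top. call_fun \<eta> k < e"
    using assms(2) by (auto simp: call_fun_def dest: order_tendstoD(2))
  then show thesis
    using that by (auto simp: eventually_at_top_linorder)
qed

lemma convex_on_max:
  fixes f g :: "real \<Rightarrow> real"
  assumes "convex_on UNIV f" and "convex_on UNIV g"
  shows "convex_on UNIV (\<lambda>x. max (f x) (g x))"
proof (rule convex_onI)
  fix t x y :: real assume t: "0 < t" "t < 1"
  have "f ((1 - t) *\<^sub>R x + t *\<^sub>R y) \<le> (1 - t) * max (f x) (g x) + t * max (f y) (g y)"
    by (rule order_trans[OF convex_onD[OF assms(1)]])
       (use t in \<open>auto intro!: add_mono mult_left_mono\<close>)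
  moreover have "g ((1 - t) *\<^sub>R x + t *\<^sub>R y) \<le> (1 - t) * max (f x) (g x) + t * max (f y) (g y)"
    by (rule order_trans[OF convex_onD[OF assms(2)]])
       (use t in \<open>auto intro!: add_mono mult_left_mono\<close>)
  ultimately show "max (f ((1 - t) *\<^sub>R x + t *\<^sub>R y)) (g ((1 - t) *\<^sub>R x + t *\<^sub>R y))
      \<le> (1 - t) * max (f x) (g x) + t * max (f y) (g y)"
    by simp
qed simp

lemma convex_le_put_fun:
  assumes "convex_le \<eta> \<theta>" and "\<theta> \<in> meas_class"
  shows "put_fun \<eta> k \<le> put_fun \<theta> k"
proof -
  have "convex_on UNIV (\<lambda>x. max (k - x) 0)"
    by (intro convex_on_max) (auto simp: convex_on_def algebra_simps simp flip: distrib_right)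
  then show ?thesis
    using assms integrable_put[OF assms(2)] unfolding convex_le_def put_fun_def by blast
qed

lemma convex_le_call_fun:
  assumes "convex_le \<eta> \<theta>" and "\<theta> \<in> meas_class"
  shows "call_fun \<eta> k \<le> call_fun \<theta> k"
proof -
  have "convex_on UNIV (\<lambda>x. max (x - k) 0)"
    by (intro convex_on_max) (auto simp: convex_on_def algebra_simps simp flip: distrib_right)
  then show ?thesis
    using assms integrable_call[OF assms(2)] unfolding convex_le_def call_fun_def by blast
qed

section \<open>Admissible maps with slope one off the contact set\<close>

locale slope_one_map =
  fixes \<mu> \<nu> :: "real measure" and T :: "real \<Rightarrow> real"
  assumes mu: "\<mu> \<in> meas_class" and nu: "\<nu> \<in> meas_class"
    and mass_eq: "measure \<mu> UNIV = measure \<nu> UNIV"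
    and put_gap_pos: "0 < put_gap \<mu> \<nu>" and call_gap_pos: "0 < call_gap \<mu> \<nu>"
    and adm: "admissible \<mu> \<nu> T"
    and slope_one: "slope_one_off_contact \<mu> \<nu> T"
begin

abbreviation \<eta> :: "real measure" where "\<eta> \<equiv> distr \<mu> borel T"

text \<open>The mass that \<open>T\<close> transports to the right, weighted by distance; it turns out to
  be \<open>put_gap \<mu> \<nu>\<close>.\<close>

definition right_cost :: real where
  "right_cost = (\<integral>x. max (T x - x) 0 \<partial>\<mu>)"

definition maximizers :: "real set" where
  "maximizers = {k. put_fun \<nu> k + put_gap \<mu> \<nu> = put_fun \<mu> k}"

lemma x_minus_eq: "x_minus \<mu> \<nu> = Inf maximizers"
  and x_plus_eq: "x_plus \<mu> \<nu> = Sup maximizers"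
  by (simp_all add: x_minus_def x_plus_def maximizers_def)

lemma T_mono: "x \<le> y \<Longrightarrow> T x \<le> T y"
  using adm by (auto simp: admissible_def dest: monoD)

lemma T_lipschitz: "1-lipschitz_on UNIV T"
  using adm by (simp add: admissible_def)

lemma displacement_antimono: "x \<le> y \<Longrightarrow> T y - y \<le> T x - x"
  using lipschitz_onD[OF T_lipschitz, of y x] T_mono[of x y] by (simp add: dist_real_def)

lemma continuous_T: "continuous_on UNIV T"
  using T_lipschitz by (rule lipschitz_on_continuous_on)

lemma measurable_T [measurable]: "T \<in> borel_measurable borel"
  by (rule borel_measurable_continuous_onI[OF continuous_T])

lemma measurable_T_mu [measurable]: "T \<in> borel_measurable \<mu>"
  using measurable_T meas_classD(1)[OF mu] by (simp cong: measurable_cong_sets)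

lemma T_growth: "\<bar>T x\<bar> \<le> \<bar>T 0\<bar> + \<bar>x\<bar>"
  using lipschitz_onD[OF T_lipschitz, of x 0] by (auto simp: dist_real_def)

lemma integrable_T: "integrable \<mu> T"
  by (rule meas_class_integrable_linear_growth[OF mu measurable_T T_growth])

lemma image_in_meas_class: "\<eta> \<in> meas_class"
proof -
  interpret finite_measure \<mu> by (rule meas_classD(3)[OF mu])
  have "finite_measure \<eta>"
    by (rule finite_measure_distr) simp
  then show ?thesis
    using integrable_T by (simp add: meas_class_def integrable_distr_eq)
qed

lemma put_fun_image: "put_fun \<eta> k = (\<integral>x. max (k - T x) 0 \<partial>\<mu>)"
  unfolding put_fun_def by (rule integral_distr) auto

lemma call_fun_image: "call_fun \<eta> k = (\<integral>x. max (T x - k) 0 \<partial>\<mu>)"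
  unfolding call_fun_def by (rule integral_distr) auto

lemma integrable_put_image: "integrable \<mu> (\<lambda>x. max (k - T x) 0)"
  using integrable_put[OF image_in_meas_class, of k] by (subst (asm) integrable_distr_eq) auto

lemma integrable_call_image: "integrable \<mu> (\<lambda>x. max (T x - k) 0)"
  using integrable_call[OF image_in_meas_class, of k] by (subst (asm) integrable_distr_eq) auto

lemma integrable_right_displacement: "integrable \<mu> (\<lambda>x. max (T x - x) 0)"
  using integrable_T meas_classD(4)[OF mu] by auto

lemma put_image_le: "put_fun \<eta> k \<le> put_fun \<nu> k"
  and call_image_le: "call_fun \<eta> k \<le> call_fun \<nu> k"
  using adm nu by (auto simp: admissible_def convex_le_put_fun convex_le_call_fun)

text \<open>Moving all mass to the left can only increase the put function, so a positive put gap
  needs a point that is moved to the right.\<close>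

lemma ex_moved_right: "\<exists>x. x < T x"
proof (rule ccontr)
  assume "\<not> ?thesis"
  then have left: "T x \<le> x" for x
    by (simp add: not_less)
  have "put_fun \<mu> k - put_fun \<nu> k \<le> 0" for k
  proof -
    have "put_fun \<mu> k \<le> put_fun \<eta> k"
      unfolding put_fun_image unfolding put_fun_def
      by (intro integral_mono integrable_put[OF mu] integrable_put_image max.mono diff_left_mono left)
         auto
    with put_image_le[of k] show ?thesis
      by simp
  qed
  then have "put_gap \<mu> \<nu> \<le> 0"
    unfolding put_gap_def by (intro cSUP_least) auto
  with put_gap_pos show False
    by simp
qed

lemma ex_call_gap: "\<exists>k. call_fun \<nu> k < call_fun \<mu> k"
proof (rule ccontr)
  assume "\<not> ?thesis"
  then have "call_gap \<mu> \<nu> \<le> 0"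
    unfolding call_gap_def by (intro cSUP_least) (auto simp: not_less)
  with call_gap_pos show False
    by simp
qed

lemma ex_moved_left: "\<exists>x. T x < x"
proof (rule ccontr)
  assume "\<not> ?thesis"
  then have right: "x \<le> T x" for x
    by (simp add: not_less)
  obtain k where "call_fun \<nu> k < call_fun \<mu> k"
    using ex_call_gap by blast
  also have "call_fun \<mu> k \<le> call_fun \<eta> k"
    unfolding call_fun_image unfolding call_fun_def
    by (intro integral_mono integrable_call[OF mu] integrable_call_image max.mono diff_right_mono right)
       auto
  finally show False
    using call_image_le[of k] by simp
qed

section \<open>Extreme fixed points are contact points\<close>

lemma fixed_point_moves_towards:
  assumes "T z = z"
  shows "x \<le> z \<Longrightarrow> x \<le> T x \<and> T x \<le> z" and "z \<le> x \<Longrightarrow> z \<le> T x \<and> T x \<le> x"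
  using assms displacement_antimono[of x z] displacement_antimono[of z x] T_mono[of x z] T_mono[of z x]
  by auto

text \<open>Near a fixed point \<open>z\<close> that is not a contact point, \<open>T\<close> takes values in the
  component of \<open>z\<close>, and there it has slope one, so it is the identity.\<close>

lemma fixed_near_noncontact_fixed_point:
  assumes "T z = z" and "put_fun \<eta> z \<noteq> put_fun \<nu> z"
  obtains \<delta> where "0 < \<delta>" and "\<And>x. \<bar>x - z\<bar> < \<delta> \<Longrightarrow> T x = x"
proof -
  define U where "U = {k. put_fun \<eta> k < put_fun \<nu> k}"
  define I where "I = connected_component_set U z"
  have "open U"
    unfolding U_def
    by (intro open_Collect_less continuous_on_put_fun image_in_meas_class nu)
  have "z \<in> U"
    using assms(2) put_image_le[of z] by (simp add: U_def)
  then have I: "I \<in> components U" "z \<in> I"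
    by (auto simp: I_def components_def)
  have "open I"
    using \<open>open U\<close> by (simp add: I_def open_connected_component)
  then have "open (T -` I)"
    using continuous_T by (simp add: continuous_on_open_vimage)
  moreover have "z \<in> T -` I"
    using I assms(1) by simp
  ultimately obtain \<delta> where \<delta>: "0 < \<delta>" "ball z \<delta> \<subseteq> T -` I"
    using open_contains_ball by metis
  show thesis
  proof
    show "0 < \<delta>" by fact
    fix x assume "\<bar>x - z\<bar> < \<delta>"
    then have "x \<in> T -` I"
      using \<delta>(2) by (auto simp: subset_iff dist_real_def abs_minus_commute)
    then have "T x - T z = x - z"
      using slope_one I(1) \<open>z \<in> T -` I\<close> unfolding slope_one_off_contact_def U_def by blast
    then show "T x = x"
      using assms(1) by simp
  qed
qed

lemma ex_first_fixed_point:
  obtains a where "T a = a" and "\<And>x. x < a \<Longrightarrow> x < T x" and "put_fun \<eta> a = put_fun \<nu> a"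
proof -
  define L where "L = {x. T x \<le> x}"
  obtain r where r: "r < T r"
    using ex_moved_right by blast
  have "L \<noteq> {}"
    using ex_moved_left by (auto simp: L_def intro: less_imp_le)
  have "closed L"
    unfolding L_def by (intro closed_Collect_le continuous_T continuous_on_id)
  have "r \<le> x" if "x \<in> L" for x
    using that r displacement_antimono[of x r] by (force simp: L_def)
  then have bdd: "bdd_below L"
    by (auto simp: bdd_below_def)
  define a where "a = Inf L"
  have "a \<in> L"
    unfolding a_def by (rule closed_contains_Inf) fact+
  have before: "x < T x" if "x < a" for x
    using that cInf_lower[OF _ bdd, of x] by (force simp: a_def L_def not_le)
  have "T a = a"
  proof (rule antisym)
    show "T a \<le> a"
      using \<open>a \<in> L\<close> by (simp add: L_def)
    show "a \<le> T a"
    proof (rule dense_le)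
      fix x assume "x < a"
      then show "x \<le> T a"
        using before[of x] T_mono[of x a] by simp
    qed
  qed
  moreover have "put_fun \<eta> a = put_fun \<nu> a"
  proof (rule ccontr)
    assume "put_fun \<eta> a \<noteq> put_fun \<nu> a"
    with \<open>T a = a\<close> obtain \<delta> where \<delta>: "0 < \<delta>" "\<And>x. \<bar>x - a\<bar> < \<delta> \<Longrightarrow> T x = x"
      using fixed_near_noncontact_fixed_point by blast
    then show False
      using before[of "a - \<delta> / 2"] \<delta>(2)[of "a - \<delta> / 2"] by simp
  qed
  ultimately show thesis
    using that before by blast
qed

lemma ex_last_fixed_point:
  obtains b where "T b = b" and "\<And>x. b < x \<Longrightarrow> T x < x" and "put_fun \<eta> b = put_fun \<nu> b"
proof -
  define R where "R = {x. x \<le> T x}"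
  obtain l where l: "T l < l"
    using ex_moved_left by blast
  have "R \<noteq> {}"
    using ex_moved_right by (auto simp: R_def intro: less_imp_le)
  have "closed R"
    unfolding R_def by (intro closed_Collect_le continuous_T continuous_on_id)
  have "x \<le> l" if "x \<in> R" for x
    using that l displacement_antimono[of l x] by (force simp: R_def)
  then have bdd: "bdd_above R"
    by (auto simp: bdd_above_def)
  define b where "b = Sup R"
  have "b \<in> R"
    unfolding b_def by (rule closed_contains_Sup) fact+
  have after: "T x < x" if "b < x" for x
    using that cSup_upper[OF _ bdd, of x] by (force simp: b_def R_def not_le)
  have "T b = b"
  proof (rule antisym)
    show "b \<le> T b"
      using \<open>b \<in> R\<close> by (simp add: R_def)
    show "T b \<le> b"
    proof (rule dense_ge)
      fix x assume "b < x"
      then show "T b \<le> x"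
        using after[of x] T_mono[of b x] by simp
    qed
  qed
  moreover have "put_fun \<eta> b = put_fun \<nu> b"
  proof (rule ccontr)
    assume "put_fun \<eta> b \<noteq> put_fun \<nu> b"
    with \<open>T b = b\<close> obtain \<delta> where \<delta>: "0 < \<delta>" "\<And>x. \<bar>x - b\<bar> < \<delta> \<Longrightarrow> T x = x"
      using fixed_near_noncontact_fixed_point by blast
    then show False
      using after[of "b + \<delta> / 2"] \<delta>(2)[of "b + \<delta> / 2"] by simp
  qed
  ultimately show thesis
    using that after by blast
qed

section \<open>The maximizers of the difference of the put functions\<close>

lemma put_diff_le_right_cost: "put_fun \<mu> k - put_fun \<eta> k \<le> right_cost"
proof -
  have "put_fun \<mu> k - put_fun \<eta> k = (\<integral>x. max (k - x) 0 - max (k - T x) 0 \<partial>\<mu>)"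
    unfolding put_fun_image unfolding put_fun_def
    by (rule Bochner_Integration.integral_diff[symmetric])
       (use integrable_put[OF mu] integrable_put_image in auto)
  also have "\<dots> \<le> right_cost"
    unfolding right_cost_def
    by (intro integral_mono Bochner_Integration.integrable_diff integrable_put[OF mu]
          integrable_put_image integrable_right_displacement) auto
  finally show ?thesis .
qed

lemma put_diff_fixed_point:
  assumes "T z = z"
  shows "put_fun \<mu> z - put_fun \<eta> z = right_cost"
proof -
  have "put_fun \<mu> z - put_fun \<eta> z = (\<integral>x. max (z - x) 0 - max (z - T x) 0 \<partial>\<mu>)"
    unfolding put_fun_image unfolding put_fun_def
    by (rule Bochner_Integration.integral_diff[symmetric])
       (use integrable_put[OF mu] integrable_put_image in auto)
  also have "\<dots> = right_cost"
    unfolding right_cost_def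
  proof (rule Bochner_Integration.integral_cong[OF refl])
    fix x
    show "max (z - x) 0 - max (z - T x) 0 = max (T x - x) 0"
      using fixed_point_moves_towards[OF assms, of x] by (cases "x \<le> z") auto
  qed
  finally show ?thesis .
qed

lemma put_gap_eq_right_cost: "put_gap \<mu> \<nu> = right_cost"
proof -
  obtain a where a: "T a = a" "put_fun \<eta> a = put_fun \<nu> a"
    using ex_first_fixed_point by metis
  have "put_fun \<mu> k - put_fun \<nu> k \<le> right_cost" for k
    using put_diff_le_right_cost[of k] put_image_le[of k] by simp
  moreover have "put_fun \<mu> a - put_fun \<nu> a = right_cost"
    using put_diff_fixed_point[OF a(1)] a(2) by simp
  ultimately show ?thesis
    unfolding put_gap_def by (intro cSup_eq_maximum) (auto intro: range_eqI[OF sym])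
qed

lemma contact_fixed_point_in_maximizers:
  assumes "T z = z" and "put_fun \<eta> z = put_fun \<nu> z"
  shows "z \<in> maximizers"
  using put_diff_fixed_point[OF assms(1)] assms(2)
  by (simp add: maximizers_def put_gap_eq_right_cost)

lemma maximizer_contact:
  assumes "k \<in> maximizers"
  shows "put_fun \<eta> k = put_fun \<nu> k" and "put_fun \<mu> k - put_fun \<eta> k = right_cost"
  using assms put_diff_le_right_cost[of k] put_image_le[of k]
  by (auto simp: maximizers_def put_gap_eq_right_cost)

text \<open>The pointwise inequality between the integrands is an almost sure equality at a maximizer,
  and the equality says that \<open>T x\<close> lies between \<open>x\<close> and \<open>k\<close>.\<close>

lemma AE_moves_towards_maximizer:
  assumes "k \<in> maximizers"
  shows "AE x in \<mu>. (x \<le> k \<longrightarrow> x \<le> T x \<and> T x \<le> k) \<and> (k \<le> x \<longrightarrow> k \<le> T x \<and> T x \<le> x)"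
proof -
  let ?f = "\<lambda>x. max (T x - x) 0 - (max (k - x) 0 - max (k - T x) 0)"
  have int: "integrable \<mu> ?f"
    by (intro Bochner_Integration.integrable_diff integrable_put[OF mu]
          integrable_put_image integrable_right_displacement)
  have "(\<integral>x. ?f x \<partial>\<mu>) = right_cost - (put_fun \<mu> k - put_fun \<eta> k)"
    unfolding right_cost_def put_fun_image unfolding put_fun_def
    by (simp add: integrable_put[OF mu] integrable_put_image integrable_right_displacement)
  also have "\<dots> = 0"
    using maximizer_contact(2)[OF assms] by simp
  finally have "AE x in \<mu>. ?f x = 0"
    by (subst (asm) integral_nonneg_eq_0_iff_AE[OF int]) auto
  then show ?thesis
    by eventually_elim (auto simp: max_def split: if_splits)
qed

lemma closed_maximizers: "closed maximizers"
  unfolding maximizers_def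
  by (intro closed_Collect_eq continuous_intros continuous_on_put_fun mu nu)

lemma bdd_below_maximizers: "bdd_below maximizers"
proof -
  obtain l where l: "\<And>k. k \<le> l \<Longrightarrow> put_fun \<mu> k < put_gap \<mu> \<nu>"
    using put_fun_eventually_less[OF mu put_gap_pos] by metis
  have "l \<le> k" if "k \<in> maximizers" for k
    using that l[of k] put_fun_nonneg[of \<nu> k] by (force simp: maximizers_def)
  then show ?thesis
    by (auto simp: bdd_below_def)
qed

text \<open>By put-call parity and equality of masses, the differences of the call functions and of the
  put functions differ by a constant, so they have the same maximizers. The maximum of the former is
  positive, whereas call functions vanish at infinity.\<close>

lemma bdd_above_maximizers: "bdd_above maximizers"
proof -
  define c where "c = (\<integral>x. x \<partial>\<nu>) - (\<integral>x. x \<partial>\<mu>)"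
  have parity: "call_fun \<mu> k - call_fun \<nu> k = put_fun \<mu> k - put_fun \<nu> k - c" for k
    using put_call_parity[OF mu, of k] put_call_parity[OF nu, of k] mass_eq by (simp add: c_def)
  obtain k0 where k0: "call_fun \<nu> k0 < call_fun \<mu> k0"
    using ex_call_gap by blast
  have "0 < put_gap \<mu> \<nu> - c"
    using k0 parity[of k0] put_diff_le_right_cost[of k0] put_image_le[of k0]
    by (simp add: put_gap_eq_right_cost)
  then obtain u where u: "\<And>k. u \<le> k \<Longrightarrow> call_fun \<mu> k < put_gap \<mu> \<nu> - c"
    using call_fun_eventually_less[OF mu] by blast
  have "k \<le> u" if "k \<in> maximizers" for k
    using that u[of k] parity[of k] call_fun_nonneg[of \<nu> k] by (force simp: maximizers_def)
  then show ?thesis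
    by (auto simp: bdd_above_def)
qed

lemma maximizers_nonempty: "maximizers \<noteq> {}"
  using ex_first_fixed_point contact_fixed_point_in_maximizers by (metis empty_iff)

lemma x_minus_in_maximizers: "x_minus \<mu> \<nu> \<in> maximizers"
  unfolding x_minus_eq
  by (rule closed_contains_Inf[OF maximizers_nonempty bdd_below_maximizers closed_maximizers])

lemma x_plus_in_maximizers: "x_plus \<mu> \<nu> \<in> maximizers"
  unfolding x_plus_eq
  by (rule closed_contains_Sup[OF maximizers_nonempty bdd_above_maximizers closed_maximizers])

lemma x_minus_le_x_plus: "x_minus \<mu> \<nu> \<le> x_plus \<mu> \<nu>"
  unfolding x_plus_eq by (rule cSup_upper[OF x_minus_in_maximizers bdd_above_maximizers])

section \<open>The sign of the displacement\<close>

lemma moved_right_before_x_minus: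
  assumes "x < x_minus \<mu> \<nu>"
  shows "x < T x"
proof -
  obtain a where a: "T a = a" "\<And>x. x < a \<Longrightarrow> x < T x" "put_fun \<eta> a = put_fun \<nu> a"
    using ex_first_fixed_point by blast
  have "x_minus \<mu> \<nu> \<le> a"
    unfolding x_minus_eq using a contact_fixed_point_in_maximizers
    by (intro cInf_lower bdd_below_maximizers) auto
  with assms show ?thesis
    by (intro a(2)) simp
qed

lemma moved_left_after_x_plus:
  assumes "x_plus \<mu> \<nu> < x"
  shows "T x < x"
proof -
  obtain b where b: "T b = b" "\<And>x. b < x \<Longrightarrow> T x < x" "put_fun \<eta> b = put_fun \<nu> b"
    using ex_last_fixed_point by blast
  have "b \<le> x_plus \<mu> \<nu>"
    unfolding x_plus_eq using b contact_fixed_point_in_maximizers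
    by (intro cSup_upper bdd_above_maximizers) auto
  with assms show ?thesis
    by (intro b(2)) simp
qed

lemma AE_fixed_between:
  "AE x in \<mu>. x \<in> {x_minus \<mu> \<nu>..x_plus \<mu> \<nu>} \<longrightarrow> T x = x"
  using AE_moves_towards_maximizer[OF x_minus_in_maximizers]
    AE_moves_towards_maximizer[OF x_plus_in_maximizers]
  by eventually_elim auto

section \<open>A version of the map that fixes the whole interval\<close>

text \<open>This is \<open>min (T x) x\<^sup>-\<close> before \<open>x\<^sup>-\<close>, the identity on \<open>[x\<^sup>-, x\<^sup>+]\<close>, and
  \<open>max (T x) x\<^sup>+\<close> after \<open>x\<^sup>+\<close>. As a lattice expression in non-decreasing 1-Lipschitz functions it
  visibly is one itself.\<close>

definition clamped_map :: "real \<Rightarrow> real" where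
  "clamped_map x = max (min (T x) (max x (x_minus \<mu> \<nu>))) (min x (x_plus \<mu> \<nu>))"

lemma clamped_map_before:
  assumes "x \<le> x_minus \<mu> \<nu>"
  shows "clamped_map x = min (T x) (x_minus \<mu> \<nu>)"
proof (cases "x = x_minus \<mu> \<nu>")
  case True
  have "x_minus \<mu> \<nu> \<le> T (x_minus \<mu> \<nu>)"
  proof (rule dense_le)
    fix y assume "y < x_minus \<mu> \<nu>"
    then show "y \<le> T (x_minus \<mu> \<nu>)"
      using moved_right_before_x_minus[of y] T_mono[of y "x_minus \<mu> \<nu>"] by simp
  qed
  then show ?thesis
    using True x_minus_le_x_plus by (simp add: clamped_map_def)
next
  case False
  then show ?thesis
    using assms moved_right_before_x_minus[of x] x_minus_le_x_plus by (simp add: clamped_map_def)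
qed

lemma clamped_map_between:
  assumes "x_minus \<mu> \<nu> \<le> x" and "x \<le> x_plus \<mu> \<nu>"
  shows "clamped_map x = x"
  using assms by (simp add: clamped_map_def)

lemma clamped_map_after:
  assumes "x_plus \<mu> \<nu> < x"
  shows "clamped_map x = max (T x) (x_plus \<mu> \<nu>)"
  using assms moved_left_after_x_plus[OF assms] x_minus_le_x_plus by (simp add: clamped_map_def)

lemma AE_clamped_map_eq: "AE x in \<mu>. clamped_map x = T x"
  using AE_moves_towards_maximizer[OF x_minus_in_maximizers]
    AE_moves_towards_maximizer[OF x_plus_in_maximizers]
  by eventually_elim (auto simp: clamped_map_def max_def min_def)

lemma clamped_map_mono: "mono clamped_map"
  unfolding clamped_map_def
  by (intro monoI max.mono min.mono) (auto intro: T_mono)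

lemma clamped_map_displacement_antimono: "antimono (\<lambda>x. clamped_map x - x)"
proof (rule antimonoI)
  fix x y :: real assume "x \<le> y"
  then show "clamped_map y - y \<le> clamped_map x - x"
    using displacement_antimono[of x y] by (auto simp: clamped_map_def max_def min_def)
qed

lemma clamped_map_lipschitz: "1-lipschitz_on UNIV clamped_map"
proof (rule lipschitz_onI)
  have "\<bar>clamped_map x - clamped_map y\<bar> \<le> \<bar>x - y\<bar>" if "x \<le> y" for x y
    using that monoD[OF clamped_map_mono that] antimonoD[OF clamped_map_displacement_antimono that]
    by simp
  then show "dist (clamped_map x) (clamped_map y) \<le> 1 * dist x y" for x y
    by (metis abs_minus_commute dist_real_def linear mult_1)
qed simp

lemma distr_clamped_map: "distr \<mu> borel clamped_map = \<eta>"
proof (rule distr_cong_AE)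
  have "clamped_map \<in> borel_measurable borel"
    by (rule borel_measurable_continuous_onI[OF lipschitz_on_continuous_on[OF clamped_map_lipschitz]])
  then show "clamped_map \<in> borel_measurable \<mu>"
    using meas_classD(1)[OF mu] by (simp cong: measurable_cong_sets)
qed (rule refl measurable_T_mu AE_clamped_map_eq)+

text \<open>The contact points \<open>x\<^sup>-\<close> and \<open>x\<^sup>+\<close> separate the components off the contact set. On the
  preimage of a component the clamped map is therefore either \<open>T\<close> or the identity throughout.\<close>

lemma clamped_map_slope_one: "slope_one_off_contact \<mu> \<nu> clamped_map"
  unfolding slope_one_off_contact_def distr_clamped_map
proof (intro ballI)
  fix I x y
  assume I: "I \<in> components {k. put_fun \<eta> k < put_fun \<nu> k}"
    and x: "x \<in> clamped_map -` I" and y: "y \<in> clamped_map -` I"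
  have slope: "T y - T x = y - x" if "T x \<in> I" "T y \<in> I"
    using slope_one[unfolded slope_one_off_contact_def, rule_format, OF I, of x y] that
    by (metis vimageI2)
  have "connected I"
    using I by (rule in_components_connected)
  then have between: "w \<in> I" if "u \<in> I" "v \<in> I" "u \<le> w" "w \<le> v" for u v w
    using that unfolding connected_iff_interval by blast
  have noncontact: "put_fun \<eta> k < put_fun \<nu> k" if "k \<in> I" for k
    using in_components_subset[OF I] that by auto
  have minus: "x_minus \<mu> \<nu> \<notin> I"
    using noncontact maximizer_contact(1)[OF x_minus_in_maximizers] by force
  have plus: "x_plus \<mu> \<nu> \<notin> I"
    using noncontact maximizer_contact(1)[OF x_plus_in_maximizers] by force
  have before: "clamped_map z = T z" if "clamped_map z < x_minus \<mu> \<nu>" for z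
    using that clamped_map_before[of z] clamped_map_between[of z] clamped_map_after[of z]
      x_minus_le_x_plus
    by (cases "z \<le> x_minus \<mu> \<nu>"; cases "z \<le> x_plus \<mu> \<nu>")
       (auto simp: min_def max_def split: if_splits)
  have after: "clamped_map z = T z" if "x_plus \<mu> \<nu> < clamped_map z" for z
    using that clamped_map_before[of z] clamped_map_between[of z] clamped_map_after[of z]
      x_minus_le_x_plus
    by (cases "z \<le> x_minus \<mu> \<nu>"; cases "z \<le> x_plus \<mu> \<nu>")
       (auto simp: min_def max_def split: if_splits)
  have middle: "clamped_map z = z"
    if "x_minus \<mu> \<nu> < clamped_map z" "clamped_map z < x_plus \<mu> \<nu>" for z
    using that clamped_map_before[of z] clamped_map_between[of z] clamped_map_after[of z]
    by (cases "z \<le> x_minus \<mu> \<nu>"; cases "z \<le> x_plus \<mu> \<nu>") auto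
  have same_minus: "clamped_map x < x_minus \<mu> \<nu> \<longleftrightarrow> clamped_map y < x_minus \<mu> \<nu>"
    using between x y minus by (metis not_le vimageD less_imp_le)
  have same_plus: "x_plus \<mu> \<nu> < clamped_map x \<longleftrightarrow> x_plus \<mu> \<nu> < clamped_map y"
    using between x y plus by (metis not_le vimageD less_imp_le)
  have neq: "clamped_map z \<noteq> x_minus \<mu> \<nu>" "clamped_map z \<noteq> x_plus \<mu> \<nu>" if "clamped_map z \<in> I" for z
    using that minus plus by auto
  consider "clamped_map x < x_minus \<mu> \<nu>" | "x_plus \<mu> \<nu> < clamped_map x"
    | "x_minus \<mu> \<nu> < clamped_map x" "clamped_map x < x_plus \<mu> \<nu>"
    using neq[of x] x by fastforce
  then show "clamped_map y - clamped_map x = y - x"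
  proof cases
    case 1
    then show ?thesis
      using before[of x] before[of y] same_minus slope x y by auto
  next
    case 2
    then show ?thesis
      using after[of x] after[of y] same_plus slope x y by auto
  next
    case 3
    then have "clamped_map x = x" "clamped_map y = y"
      using middle[of x] middle[of y] same_minus same_plus neq[of y] y by fastforce+
    then show ?thesis
      by simp
  qed
qed

lemma admissible_clamped_map: "admissible \<mu> \<nu> clamped_map"
  using adm clamped_map_mono clamped_map_lipschitz
  by (simp add: admissible_def distr_clamped_map)

end

section \<open>Monotonicity and sign of the displacement of the optimal map\<close>

theorem corollary3p1:
  fixes \<mu> \<nu> :: "real measure" and T :: "real \<Rightarrow> real"
  assumes "\<mu> \<in> meas_class" and "\<nu> \<in> meas_class"
    and "measure \<mu> UNIV = measure \<nu> UNIV"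
    and "min (put_gap \<mu> \<nu>) (call_gap \<mu> \<nu>) > 0"
    and "optimal_map \<mu> \<nu> T"
  shows "antimono (\<lambda>x. T x - x)
    \<and> (\<forall>x \<in> {..<x_minus \<mu> \<nu>}. T x - x > 0)
    \<and> (AE x in \<mu>. x \<in> {x_minus \<mu> \<nu>..x_plus \<mu> \<nu>} \<longrightarrow> T x - x = 0)
    \<and> (\<forall>x \<in> {x_plus \<mu> \<nu><..}. T x - x < 0)
    \<and> (\<exists>T'. optimal_map \<mu> \<nu> T' \<and> (AE x in \<mu>. T' x = T x)
          \<and> antimono (\<lambda>x. T' x - x)
          \<and> (\<forall>x \<in> {..<x_minus \<mu> \<nu>}. T' x - x > 0)
          \<and> (\<forall>x \<in> {x_minus \<mu> \<nu>..x_plus \<mu> \<nu>}. T' x - x = 0)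
          \<and> (\<forall>x \<in> {x_plus \<mu> \<nu><..}. T' x - x < 0))"
proof -
  interpret slope_one_map \<mu> \<nu> T
    using assms by unfold_locales (auto simp: optimal_map_def)
  have "optimal_map \<mu> \<nu> clamped_map"
    using assms(5) admissible_clamped_map clamped_map_slope_one
    by (simp add: optimal_map_def distr_clamped_map)
  moreover have "x < clamped_map x" if "x < x_minus \<mu> \<nu>" for x
    using that moved_right_before_x_minus clamped_map_before[of x] by simp
  moreover have "clamped_map x < x" if "x_plus \<mu> \<nu> < x" for x
    using that moved_left_after_x_plus clamped_map_after[of x] by simp
  ultimately have "\<exists>T'. optimal_map \<mu> \<nu> T' \<and> (AE x in \<mu>. T' x = T x)
          \<and> antimono (\<lambda>x. T' x - x)
          \<and> (\<forall>x \<in> {..<x_minus \<mu> \<nu>}. T' x - x > 0)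
          \<and> (\<forall>x \<in> {x_minus \<mu> \<nu>..x_plus \<mu> \<nu>}. T' x - x = 0)
          \<and> (\<forall>x \<in> {x_plus \<mu> \<nu><..}. T' x - x < 0)"
    using AE_clamped_map_eq clamped_map_displacement_antimono clamped_map_between
    by (intro exI[of _ clamped_map]) auto
  moreover have "antimono (\<lambda>x. T x - x)"
    by (rule antimonoI) (rule displacement_antimono)
  ultimately show ?thesis
    using moved_right_before_x_minus moved_left_after_x_plus AE_fixed_between by auto
qed

end
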